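(* For every integer $n \geq 0$, let $q_{n} := \int_{0}^{1} x^{n} e^{-x} \ln x \, dx$ (so that $q_0=\int_0^1 e^{-x}\ln x\,dx$). Then for every integer $n \ge 0$, $$q_{n} = n! \left[ \frac{1}{e} \sum_{k=1}^{n} \frac{1}{k} \left( e - \sum_{j=0}^{k-1} \frac{1}{j!} \right) + q_{0} \right].$$
   Context: Empty sums are $0$. *)

theory Defs
  imports "HOL-Analysis.Analysis" "HOL-Real_Asymp.Real_Asymp"
begin

(* The integrand is singular at 0; since the library sets "ln 0 = 0" it is total on {0..1}, and the
   value at this single point does not affect the integral. The lemma below shows that the
   integral genuinely exists, so that q n is not the default value of a divergent integral. *)
definition q :: "nat \<Rightarrow> real" where
  "q n = integral {0..1} (\<lambda>x. x ^ n * exp (- x) * ln x)"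

lemma q_integrand_absolutely_integrable:
  "(\<lambda>x::real. x ^ n * exp (- x) * ln x) absolutely_integrable_on {0..1}"
proof -
  have cont: "continuous_on {0..1} (\<lambda>x::real. x * ln x - x)"
  proof -
    have "continuous (at x within {0..1}) (\<lambda>x::real. x * ln x)" if "x \<in> {0..1}" for x :: real
    proof (cases "x = 0")
      case True
      have "((\<lambda>x::real. x * ln x) \<longlongrightarrow> 0) (at_right 0)"
        by real_asymp
      then have "((\<lambda>x::real. x * ln x) \<longlongrightarrow> 0) (at 0 within {0..1})"
        by (simp add: at_within_Icc_at_right)
      then show ?thesis
        using True by (simp add: continuous_within)
    next
      case False
      with that show ?thesis
        by (intro continuous_intros) auto
    qed
    then show ?thesis
      by (intro continuous_on_diff continuous_on_id) (simp add: continuous_on_eq_continuous_within)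
  qed
  have "(ln has_integral ((1::real) * ln 1 - 1) - (0 * ln 0 - 0)) {0..1}"
  proof (rule fundamental_theorem_of_calculus_interior[OF _ cont])
    fix x :: real
    assume "x \<in> {0<..<1}"
    then show "((\<lambda>x. x * ln x - x) has_vector_derivative ln x) (at x)"
      unfolding has_real_derivative_iff_has_vector_derivative[symmetric]
      by (auto intro!: derivative_eq_intros)
  qed auto
  then have "(\<lambda>x::real. - ln x) integrable_on {0..1}"
    by (intro integrable_neg) (auto simp: integrable_on_def)
  moreover have "0 \<le> - ln x" if "x \<in> {0..1}" for x :: real
    using that by (cases "x = 0") auto
  ultimately have ln: "(\<lambda>x::real. - ln x) absolutely_integrable_on {0..1}"
    by (intro nonnegative_absolutely_integrable_1) auto
  have cont': "continuous_on {0..1} (\<lambda>x::real. - (x ^ n * exp (- x)))"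
    by (intro continuous_intros)
  have "(\<lambda>x::real. - (x ^ n * exp (- x)) * - ln x) absolutely_integrable_on {0..1}"
  proof (rule absolutely_integrable_bounded_measurable_product_real[OF _ _ _ ln])
    show "(\<lambda>x::real. - (x ^ n * exp (- x))) \<in> borel_measurable (lebesgue_on {0..1})"
      using cont' by (rule continuous_imp_measurable_on_sets_lebesgue) simp
    show "bounded ((\<lambda>x::real. - (x ^ n * exp (- x))) ` {0..1})"
      using cont' by (intro compact_imp_bounded compact_continuous_image) auto
  qed simp
  then show ?thesis
    by simp
qed

end

theory Submission
  imports Defs
begin

text \<open>
  Integrating the derivative of \<open>x ^ Suc n * exp (- x) * ln x\<close>, which vanishes at both endpoints,
  gives \<open>q (Suc n) = (n + 1) * q n + I n\<close> with the lower incomplete gamma integral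
  \<open>I n = (\<integral>x = 0..1. x ^ n * exp (- x))\<close>. Dividing by \<open>fact (Suc n)\<close> makes the sum telescope.
\<close>

text \<open>Integration by parts gives \<open>I (Suc n) = (n + 1) * I n - exp (- 1)\<close>;
  unrolling this recurrence from \<open>I 0 = 1 - exp (- 1)\<close> produces the partial exponential
  sum.\<close>

lemma has_integral_power_times_exp_minus:
  "((\<lambda>x::real. x ^ n * exp (- x)) has_integral
     fact n * (1 - exp (- 1) * (\<Sum>j=0..n. 1 / fact j))) {0..1}"
proof (induction n)
  case 0
  have "((\<lambda>x::real. exp (- x)) has_integral (- exp (- 1)) - (- exp (- 0))) {0..1}"
    by (intro fundamental_theorem_of_calculus)
      (auto simp flip: has_real_derivative_iff_has_vector_derivative intro!: derivative_eq_intros)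
  then show ?case
    by simp
next
  case (Suc n)
  let ?F = "\<lambda>x::real. - (x ^ Suc n * exp (- x))"
  have "((\<lambda>x. x ^ Suc n * exp (- x) - (real n + 1) * (x ^ n * exp (- x))) has_integral
          ?F 1 - ?F 0) {0..1}"
  proof (rule fundamental_theorem_of_calculus)
    fix x :: real
    show "(?F has_vector_derivative
        x ^ Suc n * exp (- x) - (real n + 1) * (x ^ n * exp (- x))) (at x within {0..1})"
      unfolding has_real_derivative_iff_has_vector_derivative[symmetric]
      \<comment> \<open>Differentiating \<open>x ^ n\<close> leaves the truncated exponent
        \<open>n - 1\<close>, hence the case split on \<open>n\<close>.\<close>
      by (auto intro!: derivative_eq_intros simp: algebra_simps) (cases n; simp)
  qed simp
  \<comment> \<open>Adding \<open>n + 1\<close> times the induction hypothesis cancels the lower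
    power in the integrand.\<close>
  from has_integral_add[OF this has_integral_mult_right[OF Suc.IH, of "real n + 1"]]
  have "((\<lambda>x. x ^ Suc n * exp (- x)) has_integral
      ?F 1 - ?F 0 + (real n + 1) *
        (fact n * (1 - exp (- 1) * (\<Sum>j=0..n. 1 / fact j)))) {0..1}"
    by simp
  moreover have "?F 1 - ?F 0 + (real n + 1) *
        (fact n * (1 - exp (- 1) * (\<Sum>j=0..n. 1 / fact j))) =
      fact (Suc n) * (1 - exp (- 1) * (\<Sum>j=0..Suc n. 1 / fact j))"
    by (simp add: divide_simps) (simp add: algebra_simps)
  ultimately show ?case
    by metis
qed

text \<open>Only 0 is delicate: there the value \<open>0 * ln 0 = 0\<close> agrees with the
  right-hand limit.\<close>

lemma continuous_on_x_ln_x: "continuous_on {0..1} (\<lambda>x::real. x * ln x)"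
  unfolding continuous_on_eq_continuous_within
proof
  fix x :: real
  assume x: "x \<in> {0..1}"
  show "continuous (at x within {0..1}) (\<lambda>x. x * ln x)"
  proof (cases "x = 0")
    case True
    have "((\<lambda>x::real. x * ln x) \<longlongrightarrow> 0) (at_right 0)"
      by real_asymp
    with True show ?thesis
      by (simp add: continuous_within at_within_Icc_at_right)
  next
    case False
    with x show ?thesis
      by (intro continuous_intros) auto
  qed
qed

lemma q_Suc:
  "q (Suc n) = (real n + 1) * q n + fact n * (1 - exp (- 1) * (\<Sum>j=0..n. 1 / fact j))"
proof -
  let ?f = "\<lambda>n x::real. x ^ n * exp (- x) * ln x"
  have q: "(?f m has_integral q m) {0..1}" for m
    using q_integrand_absolutely_integrable[of m] unfolding q_def
    by (intro integrable_integral) (rule absolutely_integrable_on_def[THEN iffD1, THEN conjunct1])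
  \<comment> \<open>One factor \<open>x\<close> of \<open>x ^ Suc n\<close> is paired with
    \<open>ln x\<close> to absorb the singularity at 0. Continuity up to the endpoints then lets the
    fundamental theorem ask for derivatives only in the open interval.\<close>
  have "continuous_on {0..1} (\<lambda>x::real. x ^ n * exp (- x) * (x * ln x))"
    by (intro continuous_intros continuous_on_x_ln_x)
  then have cont: "continuous_on {0..1} (?f (Suc n))"
    by (simp add: mult_ac)
  have "((\<lambda>x. (real n + 1) * ?f n x - ?f (Suc n) x + x ^ n * exp (- x)) has_integral
          ?f (Suc n) 1 - ?f (Suc n) 0) {0..1}"
  proof (rule fundamental_theorem_of_calculus_interior[OF _ cont])
    fix x :: real
    assume "x \<in> {0<..<1}"
    then show "(?f (Suc n) has_vector_derivative
        (real n + 1) * ?f n x - ?f (Suc n) x + x ^ n * exp (- x)) (at x)"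
      unfolding has_real_derivative_iff_has_vector_derivative[symmetric]
      by (auto intro!: derivative_eq_intros simp: field_simps) (cases n; simp)
  qed simp
  moreover have "((\<lambda>x. (real n + 1) * ?f n x - ?f (Suc n) x + x ^ n * exp (- x)) has_integral
      (real n + 1) * q n - q (Suc n) + fact n * (1 - exp (- 1) * (\<Sum>j=0..n. 1 / fact j))) {0..1}"
    by (intro has_integral_add has_integral_diff has_integral_mult_right q
        has_integral_power_times_exp_minus)
  ultimately have "?f (Suc n) 1 - ?f (Suc n) 0 =
      (real n + 1) * q n - q (Suc n) + fact n * (1 - exp (- 1) * (\<Sum>j=0..n. 1 / fact j))"
    by (rule has_integral_unique)
  then show ?thesis
    by simp
qed

theorem proposition3p4:
  fixes n :: nat
  shows "q n = fact n *
           (1 / exp 1 * (\<Sum>k=1..n. 1 / real k * (exp 1 - (\<Sum>j=0..k-1. 1 / fact j))) + q 0)"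
proof (induction n)
  case 0
  show ?case
    by simp
next
  case (Suc n)
  define S where "S = (\<Sum>k=1..n. 1 / real k * (exp 1 - (\<Sum>j=0..k-1. 1 / fact j)))"
  \<comment> \<open>\<open>T\<close> is the inner sum of the new summand \<open>k = Suc n\<close>,
    since then \<open>k - 1 = n\<close>.\<close>
  define T :: real where "T = (\<Sum>j=0..n. 1 / fact j)"
  have "q (Suc n) = (real n + 1) * (fact n * (1 / exp 1 * S + q 0)) + fact n * (1 - exp (- 1) * T)"
    by (simp only: q_Suc Suc.IH S_def T_def)
  \<comment> \<open>Uses \<open>1 - exp (- 1) * T = (exp 1 - T) / exp 1\<close> and
    \<open>fact n = fact (Suc n) / (n + 1)\<close>.\<close>
  also have "\<dots> = fact (Suc n) * (1 / exp 1 * (S + 1 / real (Suc n) * (exp 1 - T)) + q 0)"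
    by (simp add: exp_minus divide_simps) (simp add: algebra_simps)
  also have "S + 1 / real (Suc n) * (exp 1 - T) =
      (\<Sum>k=1..Suc n. 1 / real k * (exp 1 - (\<Sum>j=0..k-1. 1 / fact j)))"
    by (simp add: S_def T_def)
  finally show ?case .
qed

end
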